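(* Let $\mathcal B$ be a unital associative $k$-algebra, let $\mathcal A$ be the space of sequences $\mathbb N\to\mathcal B$ with its tridendriform structure, and let $a\in\mathcal A$. Let $X(a),\overline X(a)$ be the solutions of $X(a)=\mathbf 1+a\prec X(a)$ and $\overline X(a)=\mathbf 1+a\preceq\overline X(a)$, and let $\Omega'(a)=\log^*(X(a))$ and $\overline\Omega'(a)=\log^*(\overline X(a))$. Then the discrete Magnus elements $\Omega(a)=S(\Omega'(a))$ and $\overline\Omega(a)=S(\overline\Omega'(a))$ are given by the (formal) series $$\Omega(a)(N)=\sum_{n>0}\sum_{\sigma\in \mathrm{ST}_n}\frac{(-1)^{d(\sigma)}}{n\binom{n-1}{d(\sigma)}}\sum_{(s_1,\dots,s_n)\in T_\sigma(N)}a(s_1)\cdots a(s_n),$$ $$\overline\Omega(a)(N)=\sum_{n>0}\sum_{\sigma\in \mathrm{ST}_n}\frac{(-1)^{\overline d(\sigma)}}{n\binom{n-1}{\overline d(\sigma)}}\sum_{(s_1,\dots,s_n)\in T_\sigma(N)}a(s_1)\cdots a(s_n).$$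
   Context: $k$ is a field of characteristic zero and $\mathbb N=\{0,1,2,\dots\}$. The summation operator on $\mathcal A$ is $S(f)(N)=\sum_{r=0}^{N-1}f(r)$ (empty sum $=0$). The tridendriform operations on $\mathcal A$ are $f\prec g=f\,S(g)$, $f\succ g=S(f)\,g$, $f\cdot g=fg$ (pointwise products), with $\preceq\,:=\,\prec+\,\cdot$ and associative product $f*g=f\prec g+f\succ g+f\cdot g$. A unit $\mathbf 1$ for $*$ is adjoined, with $f\prec\mathbf 1=f=\mathbf 1\succ f$ and $\mathbf 1\prec f=f\succ\mathbf 1=\mathbf 1\cdot f=f\cdot\mathbf 1=0$ (so $f\preceq\mathbf 1=f$). The solutions are the formal series $X(a)=\mathbf 1+a+a\prec a+a\prec(a\prec a)+\cdots$ and similarly $\overline X(a)$ with $\preceq$, and $\log^*(\mathbf 1+x)=-\sum_{n>0}(-1)^nx^{*n}/n$. All series are formal, graded by the number of occurrences of $a$ (that is, one replaces $a$ by $ha$ with a formal parameter $h$, works in $h\mathcal A[[h]]$ with a unit adjoined, and compares coefficients of each power of $h$). $\mathrm{ST}_n$ is the set of all surjective maps $\sigma:\{1,\dots,n\}\to\{1,\dots,r\}$, $1\le r\le n$. A descent of $\sigma\in \mathrm{ST}_n$ is an index $j\in\{1,\dots,n-1\}$ with $\sigma(j)\ge\sigma(j+1)$; a strict descent is one with $\sigma(j)>\sigma(j+1)$. $\overline d(\sigma)$ is the number of descents and $d(\sigma)$ the number of strict descents. For $\sigma\in \mathrm{ST}_n$, $T_\sigma(N)$ is the set of $(s_1,\dots,s_n)\in\{0,\dots,N-1\}^n$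 such that for all $i,j\in\{1,\dots,n\}$: $s_i>s_j\Leftrightarrow\sigma(i)<\sigma(j)$, and $s_i=s_j\Leftrightarrow\sigma(i)=\sigma(j)$ (possibly empty; empty for $N=0$).
   Formalization: The printed formulas have d and d̄ interchanged (they fail for a=1, N=1 in degree 2); the theorem proved uses the number of descents d̄(σ) in the series for Ω(a) and the number of strict descents d(σ) in the series for Ω̄(a). *)

theory Defs
  imports "HOL-Computational_Algebra.Formal_Power_Series" "HOL-Library.FuncSet"
begin

unbundle fps_syntax

text \<open>
  The sort \<open>{ring, monoid_mult}\<close> is that of unital associative rings in which \<open>0 = 1\<close> is
  not excluded (unlike \<open>ring_1\<close>).
\<close>

locale unital_algebra = vector_space scale
  for scale :: "'k::field_char_0 \<Rightarrow> 'b::{ring,monoid_mult} \<Rightarrow> 'b" +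
  assumes scale_mult_left: "scale c x * y = scale c (x * y)"
    and scale_mult_right: "x * scale c y = scale c (x * y)"


section \<open>Sequences and their tridendriform operations\<close>

definition summation :: "(nat \<Rightarrow> 'c::comm_monoid_add) \<Rightarrow> nat \<Rightarrow> 'c" where
  "summation f N = (\<Sum>r<N. f r)"

definition tri_prec :: "(nat \<Rightarrow> 'c::semiring_0) \<Rightarrow> (nat \<Rightarrow> 'c) \<Rightarrow> nat \<Rightarrow> 'c" where
  "tri_prec f g N = f N * summation g N"

definition tri_succ :: "(nat \<Rightarrow> 'c::semiring_0) \<Rightarrow> (nat \<Rightarrow> 'c) \<Rightarrow> nat \<Rightarrow> 'c" where
  "tri_succ f g N = summation f N * g N"

definition tri_dot :: "(nat \<Rightarrow> 'c::semiring_0) \<Rightarrow> (nat \<Rightarrow> 'c) \<Rightarrow> nat \<Rightarrow> 'c" where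
  "tri_dot f g N = f N * g N"

definition tri_preceq :: "(nat \<Rightarrow> 'c::semiring_0) \<Rightarrow> (nat \<Rightarrow> 'c) \<Rightarrow> nat \<Rightarrow> 'c" where
  "tri_preceq f g N = tri_prec f g N + tri_dot f g N"

definition tri_star :: "(nat \<Rightarrow> 'c::semiring_0) \<Rightarrow> (nat \<Rightarrow> 'c) \<Rightarrow> nat \<Rightarrow> 'c" where
  "tri_star f g N = tri_prec f g N + tri_succ f g N + tri_dot f g N"

text \<open>Powers for the associative product, without unit; only exponents \<open>n \<ge> 1\<close> are meaningful.\<close>

definition star_power :: "(nat \<Rightarrow> 'c::semiring_0) \<Rightarrow> nat \<Rightarrow> nat \<Rightarrow> 'c" where
  "star_power x n = (tri_star x ^^ (n - 1)) x"


section \<open>Formal series and the adjoined unit\<close>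

text \<open>
  If \<open>\<A>\<close> is the space of sequences in \<open>'b\<close>, then \<open>\<A>[[h]]\<close> is the space of sequences in
  \<open>'b[[h]]\<close>, that is, \<open>nat \<Rightarrow> 'b fps\<close>, and the operations above, taken with values in
  \<open>'b fps\<close>, are the \<open>h\<close>-linear extensions of those on \<open>\<A>\<close>. A pair \<open>(c, x)\<close> with
  \<open>c :: 'k\<close> and \<open>x :: nat \<Rightarrow> 'b fps\<close> stands for \<open>c \<one> + x\<close>, where \<open>\<one>\<close> is the adjoined unit.
\<close>

definition formal_seq :: "(nat \<Rightarrow> 'b::{ring,monoid_mult}) \<Rightarrow> nat \<Rightarrow> 'b fps" where
  "formal_seq a N = fps_X * fps_const (a N)"

definition fps_scale :: "('k \<Rightarrow> 'b \<Rightarrow> 'b) \<Rightarrow> 'k \<Rightarrow> 'b fps \<Rightarrow> 'b fps" where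
  "fps_scale scale c F = Abs_fps (\<lambda>m. scale c (F $ m))"

definition one_plus :: "(nat \<Rightarrow> 'b fps) \<Rightarrow> 'k::one \<times> (nat \<Rightarrow> 'b fps)" where
  "one_plus x = (1, x)"

text \<open>
  The operations with a right argument in the unital extension, determined by
  \<open>f \<prec> \<one> = f\<close> and \<open>f \<cdot> \<one> = 0\<close>.
\<close>

definition aug_prec ::
  "('k \<Rightarrow> 'b \<Rightarrow> 'b) \<Rightarrow> (nat \<Rightarrow> 'b::{ring,monoid_mult} fps) \<Rightarrow> 'k \<times> (nat \<Rightarrow> 'b fps) \<Rightarrow> nat \<Rightarrow> 'b fps"
  where "aug_prec scale f X N = fps_scale scale (fst X) (f N) + tri_prec f (snd X) N"

definition aug_dot ::
  "(nat \<Rightarrow> 'b::{ring,monoid_mult} fps) \<Rightarrow> 'k \<times> (nat \<Rightarrow> 'b fps) \<Rightarrow> nat \<Rightarrow> 'b fps"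
  where "aug_dot f X N = tri_dot f (snd X) N"

definition aug_preceq ::
  "('k \<Rightarrow> 'b \<Rightarrow> 'b) \<Rightarrow> (nat \<Rightarrow> 'b::{ring,monoid_mult} fps) \<Rightarrow> 'k \<times> (nat \<Rightarrow> 'b fps) \<Rightarrow> nat \<Rightarrow> 'b fps"
  where "aug_preceq scale f X N = aug_prec scale f X N + aug_dot f X N"

text \<open>
  The logarithm of \<open>X = \<one> + x\<close>, where \<open>x\<close> has zero constant term in \<open>h\<close>. Since \<open>x\<^sup>*\<^sup>n\<close> is
  divisible by \<open>h\<^sup>n\<close> (\<open>star_power_nth_eq_0\<close> below), only the powers with \<open>n \<le> m\<close> contribute
  to the coefficient of \<open>h\<^sup>m\<close>.
\<close>

definition star_log ::
  "('k::field_char_0 \<Rightarrow> 'b \<Rightarrow> 'b) \<Rightarrow> 'k \<times> (nat \<Rightarrow> 'b::{ring,monoid_mult} fps) \<Rightarrow> nat \<Rightarrow> 'b fps"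
  where "star_log scale X N =
    Abs_fps (\<lambda>m. - (\<Sum>n=1..m. scale ((-1) ^ n / of_nat n) (star_power (snd X) n N $ m)))"

lemma formal_seq_nth: "formal_seq a N $ m = (if m = 1 then a N else 0)"
  by (cases m) (auto simp: formal_seq_def)

lemma summation_nth: "summation f N $ m = summation (\<lambda>r. f r $ m) N"
  by (simp add: summation_def fps_sum_nth)

lemma star_power_nth_eq_0:
  fixes x :: "nat \<Rightarrow> 'b::{ring,monoid_mult} fps"
  assumes "\<And>N. x N $ 0 = 0" "m < n"
  shows "star_power x n N $ m = 0"
proof -
  have "(tri_star x ^^ k) x N $ m = 0" if "m \<le> k" for k m N
    using that
  proof (induction k arbitrary: m N)
    case (Suc k)
    have *: "(F * G) $ m = 0" "(G * F) $ m = 0"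
      if "F $ 0 = 0" "\<And>j. j \<le> k \<Longrightarrow> G $ j = 0" for F G :: "'b fps"
    proof -
      have "F $ i * G $ (m - i) = 0" for i
        using that Suc.prems by (cases i) auto
      moreover have "G $ i * F $ (m - i) = 0" for i
        using that Suc.prems by (cases "i \<le> k") auto
      ultimately show "(F * G) $ m = 0" "(G * F) $ m = 0"
        by (simp_all add: fps_mult_nth)
    qed
    let ?y = "(tri_star x ^^ k) x"
    have y: "summation ?y N $ j = 0" "?y N $ j = 0" if "j \<le> k" for j
      using Suc.IH[OF that] by (simp_all add: summation_def fps_sum_nth)
    have x: "summation x N $ 0 = 0"
      by (simp add: summation_def fps_sum_nth assms(1))
    show ?case
      using *[OF assms(1) y(1)] *[OF assms(1) y(2)] *[OF x y(2)]
      by (simp add: tri_star_def[of x ?y] tri_prec_def tri_succ_def tri_dot_def)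
  qed (simp add: assms)
  then show ?thesis
    using assms(2) by (simp add: star_power_def)
qed

lemma formal_seq_mult_nth:
  "(formal_seq a N * F) $ m = (case m of 0 \<Rightarrow> 0 | Suc k \<Rightarrow> a N * F $ k)"
proof (cases m)
  case (Suc k)
  have "(formal_seq a N * F) $ m = (\<Sum>i=0..m. if i = 1 then a N * F $ (m - 1) else 0)"
    unfolding fps_mult_nth by (intro sum.cong) (auto simp: formal_seq_nth)
  then show ?thesis
    by (simp add: Suc sum.delta)
qed (simp add: formal_seq_nth)

lemma aug_prec_formal_seq_nth:
  assumes "unital_algebra scale"
  shows "aug_prec scale (formal_seq a) (1, x) N $ m =
    (case m of 0 \<Rightarrow> 0 | Suc k \<Rightarrow> (if k = 0 then a N else 0) + tri_prec a (\<lambda>r. x r $ k) N)"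
proof -
  interpret unital_algebra scale by fact
  show ?thesis
    by (auto simp: aug_prec_def fps_scale_def formal_seq_nth tri_prec_def formal_seq_mult_nth
        summation_nth split: nat.splits)
qed

lemma aug_preceq_formal_seq_nth:
  assumes "unital_algebra scale"
  shows "aug_preceq scale (formal_seq a) (1, x) N $ m =
    (case m of 0 \<Rightarrow> 0 | Suc k \<Rightarrow> (if k = 0 then a N else 0) + tri_preceq a (\<lambda>r. x r $ k) N)"
  using aug_prec_formal_seq_nth[OF assms, of a x N m]
  by (auto simp: aug_preceq_def aug_dot_def tri_dot_def formal_seq_mult_nth tri_preceq_def
      split: nat.splits)

text \<open>
  Each of the two fixed-point equations has exactly one solution, namely
  \<open>\<one> + a + a \<prec> a + a \<prec> (a \<prec> a) + \<dots>\<close> and its analogue for \<open>\<preceq>\<close>.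
\<close>

lemma fixed_point_unique_aux:
  fixes x :: "nat \<Rightarrow> 'b::{ring,monoid_mult} fps"
  assumes "\<And>N. tri a (\<lambda>_. 0) N = 0"
  shows "(\<forall>N m. x N $ m =
      (case m of 0 \<Rightarrow> 0 | Suc k \<Rightarrow> (if k = 0 then a N else 0) + tri a (\<lambda>r. x r $ k) N)) \<longleftrightarrow>
    x = (\<lambda>N. Abs_fps (\<lambda>m. case m of 0 \<Rightarrow> 0 | Suc k \<Rightarrow> (tri a ^^ k) a N))"
    (is "?L \<longleftrightarrow> ?R")
proof
  assume L: ?L
  have "x N $ m = (case m of 0 \<Rightarrow> 0 | Suc k \<Rightarrow> (tri a ^^ k) a N)" for N m
  proof (induction m arbitrary: N)
    case (Suc k)
    have *: "x N $ Suc k = (if k = 0 then a N else 0) + tri a (\<lambda>r. x r $ k) N"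
      using L by simp
    have "(\<lambda>r. x r $ k) = (\<lambda>r. case k of 0 \<Rightarrow> 0 | Suc k \<Rightarrow> (tri a ^^ k) a r)"
      using Suc by auto
    with * show ?case
      by (cases k) (simp_all add: assms)
  qed (simp add: L)
  then show ?R
    by (intro ext) (simp add: fps_eq_iff)
next
  assume R: ?R
  show ?L
  proof (intro allI)
    fix N m
    show "x N $ m =
        (case m of 0 \<Rightarrow> 0 | Suc k \<Rightarrow> (if k = 0 then a N else 0) + tri a (\<lambda>r. x r $ k) N)"
    proof (cases m)
      case (Suc k)
      then show ?thesis
        by (cases k) (simp_all add: R assms)
    qed (simp add: R)
  qed
qed

lemma aug_prec_fixed_point_iff:
  assumes "unital_algebra scale"
  shows "X = one_plus (aug_prec scale (formal_seq a) X) \<longleftrightarrow>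
    X = one_plus (\<lambda>N. Abs_fps (\<lambda>m. case m of 0 \<Rightarrow> 0 | Suc k \<Rightarrow> (tri_prec a ^^ k) a N))"
proof (cases "fst X = 1")
  case True
  then obtain x where X: "X = (1, x)"
    by (metis prod.collapse)
  show ?thesis
    unfolding X one_plus_def
    using fixed_point_unique_aux[of tri_prec a x]
    by (simp add: fun_eq_iff fps_eq_iff aug_prec_formal_seq_nth[OF assms] tri_prec_def
        summation_def)
qed (metis fst_conv one_plus_def)

lemma aug_preceq_fixed_point_iff:
  assumes "unital_algebra scale"
  shows "X = one_plus (aug_preceq scale (formal_seq a) X) \<longleftrightarrow>
    X = one_plus (\<lambda>N. Abs_fps (\<lambda>m. case m of 0 \<Rightarrow> 0 | Suc k \<Rightarrow> (tri_preceq a ^^ k) a N))"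
proof (cases "fst X = 1")
  case True
  then obtain x where X: "X = (1, x)"
    by (metis prod.collapse)
  show ?thesis
    unfolding X one_plus_def
    using fixed_point_unique_aux[of tri_preceq a x]
    by (simp add: fun_eq_iff fps_eq_iff aug_preceq_formal_seq_nth[OF assms] tri_preceq_def
        tri_prec_def tri_dot_def summation_def)
qed (metis fst_conv one_plus_def)


section \<open>Surjections and descents\<close>

text \<open>Maps on \<open>{1..n}\<close> are represented by functions that are \<open>undefined\<close> elsewhere.\<close>

definition ST :: "nat \<Rightarrow> (nat \<Rightarrow> nat) set" where
  "ST n = {\<sigma> \<in> extensional {1..n}. \<exists>r\<in>{1..n}. \<sigma> ` {1..n} = {1..r}}"

definition descents :: "nat \<Rightarrow> (nat \<Rightarrow> nat) \<Rightarrow> nat" where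
  "descents n \<sigma> = card {j \<in> {1..<n}. \<sigma> j \<ge> \<sigma> (j + 1)}"

definition strict_descents :: "nat \<Rightarrow> (nat \<Rightarrow> nat) \<Rightarrow> nat" where
  "strict_descents n \<sigma> = card {j \<in> {1..<n}. \<sigma> j > \<sigma> (j + 1)}"

definition T :: "nat \<Rightarrow> (nat \<Rightarrow> nat) \<Rightarrow> nat \<Rightarrow> (nat \<Rightarrow> nat) set" where
  "T n \<sigma> N = {s \<in> {1..n} \<rightarrow>\<^sub>E {0..<N}. \<forall>i\<in>{1..n}. \<forall>j\<in>{1..n}.
     (s i > s j \<longleftrightarrow> \<sigma> i < \<sigma> j) \<and> (s i = s j \<longleftrightarrow> \<sigma> i = \<sigma> j)}"

definition ordered_product :: "(nat \<Rightarrow> 'b::monoid_mult) \<Rightarrow> nat \<Rightarrow> (nat \<Rightarrow> nat) \<Rightarrow> 'b" where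
  "ordered_product a n s = prod_list (map (\<lambda>i. a (s i)) [1..<n + 1])"

text \<open>
  The two statistics are not interchangeable. In \<open>a \<prec> (a \<prec> \<dots>)\<close> only strictly decreasing
  arguments \<open>s\<close> occur, i.e. \<open>\<sigma>\<close> without any descent, so ties count as descents for the
  logarithm of the solution of \<open>X = \<one> + a \<prec> X\<close>: in degree 2 it is
  \<open>a \<prec> a - (a * a) / 2 = (a \<prec> a - a \<succ> a - a \<cdot> a) / 2\<close>, with \<open>-1/2\<close> at \<open>\<sigma> = (1, 1)\<close>, which has
  one descent and no strict descent. For \<open>\<preceq>\<close> the sign at \<open>\<sigma> = (1, 1)\<close> is \<open>+1/2\<close>, and
  the strict descents are the relevant ones.
\<close>

definition magnus_series ::
  "('k::field_char_0 \<Rightarrow> 'b \<Rightarrow> 'b) \<Rightarrow> (nat \<Rightarrow> (nat \<Rightarrow> nat) \<Rightarrow> nat) \<Rightarrow>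
    (nat \<Rightarrow> 'b::{ring,monoid_mult}) \<Rightarrow> nat \<Rightarrow> 'b fps" where
  "magnus_series scale d a N = Abs_fps (\<lambda>n. if n > 0 then
     (\<Sum>\<sigma>\<in>ST n. scale ((-1) ^ d n \<sigma> / (of_nat n * of_nat ((n - 1) choose d n \<sigma>)))
        (\<Sum>s\<in>T n \<sigma> N. ordered_product a n s)) else 0)"

end

theory Submission
  imports Defs
begin

text \<open>
  Summation turns \<open>*\<close> into the pointwise product, so \<open>S (log\<^sup>* (\<one> + x))\<close> at \<open>N\<close> is the ordinary
  logarithm of \<open>1 + S x N\<close> in the algebra of formal series (\<open>summation_tri_star\<close>). For the two
  solutions, the coefficient of \<open>h\<^sup>m\<close> in \<open>S x N\<close> is the sum of \<open>a(s\<^sub>1) \<dots> a(s\<^sub>m)\<close> over the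
  words \<open>s\<^sub>1 \<dots> s\<^sub>m\<close> with letters below \<open>N\<close> that are chains for a relation \<open>R\<close>: strictly
  decreasing words for \<open>\<prec>\<close>, weakly decreasing words for \<open>\<preceq>\<close>
  (\<open>summation_funpow_eq_sum_chains\<close>). Both cases run through the same argument with \<open>R\<close> as a
  parameter.

  Consequently the coefficient of a word \<open>w\<close> in \<open>(S x N)\<^sup>n\<close> is the number of ways to cut \<open>w\<close> into
  \<open>n\<close> nonempty chains. Let \<open>D\<close> be the number of adjacent pairs of \<open>w\<close> that are not related by \<open>R\<close>.
  The cuts at these \<open>D\<close> places are forced and the others are free, which leaves
  \<open>(m - 1 - D) choose (n - 1 - D)\<close> possibilities (\<open>chain_cuts_eq_binomial\<close>). The alternating sum
  of these numbers with the weights \<open>1 / n\<close> of the logarithm is a partial fraction expansion with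
  value \<open>(-1)\<^sup>D / (m ((m - 1) choose D))\<close> (\<open>alternating_chain_cuts_sum\<close>).

  It remains to group the words by their relative order. Each word lies in \<open>T\<^sub>\<sigma>(N)\<close> for exactly one
  surjection \<open>\<sigma>\<close> (\<open>T_eq_descending_rank_fiber\<close>), and since the order is reversed, \<open>D\<close> is the
  number of descents of \<open>\<sigma>\<close> when \<open>R\<close> is strict, and of strict descents when \<open>R\<close> is weak.
\<close>


section \<open>Cutting words into chains\<close>

definition breaks :: "('a \<Rightarrow> 'a \<Rightarrow> bool) \<Rightarrow> 'a list \<Rightarrow> nat" where
  "breaks R w = length (filter (\<lambda>(x, y). \<not> R x y) (zip w (tl w)))"

text \<open>
  The number of ways to cut a word into \<open>n + 1\<close> (not \<open>n\<close>) nonempty consecutive factors that are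
  chains for \<open>R\<close>. The shift matches powers that start from the first one, as there is no unit for
  the product of sequences. The recursion splits off the first factor, as the Cauchy product does
  when a power series is multiplied by a further factor on the left.
\<close>

primrec chain_cuts :: "('a \<Rightarrow> 'a \<Rightarrow> bool) \<Rightarrow> nat \<Rightarrow> 'a list \<Rightarrow> nat" where
  "chain_cuts R 0 w = of_bool (w \<noteq> [] \<and> successively R w)"
| "chain_cuts R (Suc n) w =
    (\<Sum>i\<le>length w. of_bool (take i w \<noteq> [] \<and> successively R (take i w)) * chain_cuts R n (drop i w))"

lemma breaks_simps [simp]:
  "breaks R [] = 0"
  "breaks R [x] = 0"
  "breaks R (x # y # w) = (if R x y then 0 else 1) + breaks R (y # w)"
  by (simp_all add: breaks_def)

lemma breaks_eq_0_iff: "breaks R w = 0 \<longleftrightarrow> successively R w"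
  by (induction w rule: induct_list012) auto

lemma breaks_less_length: "w \<noteq> [] \<Longrightarrow> breaks R w < length w"
  by (induction w rule: induct_list012) auto

lemma breaks_map_upt:
  "breaks R (map s [1..<m + 1]) = card {j \<in> {1..<m}. \<not> R (s j) (s (j + 1))}"
proof -
  let ?w = "map s [1..<m + 1]"
  have "breaks R ?w = card {i. i < m - 1 \<and> \<not> R (s (Suc i)) (s (Suc (Suc i)))}"
    unfolding breaks_def length_filter_conv_card
    by (intro arg_cong[where f = card] Collect_cong) (auto simp: nth_tl simp del: upt_Suc)
  also have "\<dots> = card (Suc ` {i. i < m - 1 \<and> \<not> R (s (Suc i)) (s (Suc (Suc i)))})"
    by (simp add: card_image)
  also have "Suc ` {i. i < m - 1 \<and> \<not> R (s (Suc i)) (s (Suc (Suc i)))} =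
      {j \<in> {1..<m}. \<not> R (s j) (s (j + 1))}" (is "_ ` ?A = ?B")
  proof (intro equalityI subsetI)
    fix j assume "j \<in> ?B"
    then show "j \<in> Suc ` ?A"
      by (intro image_eqI[of _ _ "j - 1"]) auto
  qed auto
  finally show ?thesis .
qed

lemma chain_cuts_Nil [simp]: "chain_cuts R n [] = 0"
  by (cases n) simp_all

text \<open>
  Either the first letter is cut off on its own, or it extends the first factor of a cut of the
  remaining word; the latter is possible only if the first two letters are related. This is Pascal's
  recurrence in disguise.
\<close>

lemma chain_cuts_Cons_Cons:
  "chain_cuts R (Suc n) (x # y # w) =
    chain_cuts R n (y # w) + (if R x y then chain_cuts R (Suc n) (y # w) else 0)"
proof -
  have *: "of_bool (successively R (x # take i (y # w))) =
      (of_bool (i = 0) + of_bool (R x y) * of_bool (take i (y # w) \<noteq> [] \<and> successively R (take i (y # w))) :: nat)"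
    for i by (cases i) auto
  have "chain_cuts R (Suc n) (x # y # w) =
      (\<Sum>i\<le>length (y # w). of_bool (successively R (x # take i (y # w))) * chain_cuts R n (drop i (y # w)))"
    unfolding chain_cuts.simps(2) length_Cons[of x] sum.atMost_Suc_shift by simp
  also have "\<dots> = (\<Sum>i\<le>length (y # w). (if i = 0 then chain_cuts R n (y # w) else 0)) +
      of_bool (R x y) * chain_cuts R (Suc n) (y # w)"
    unfolding * chain_cuts.simps(2) sum_distrib_left sum.distrib[symmetric]
    by (intro sum.cong) (auto simp: algebra_simps)
  finally show ?thesis
    by simp
qed

text \<open>
  The cut must separate every unrelated adjacent pair, so the choice is about which of the other
  \<open>length w - 1 - breaks R w\<close> gaps receive the remaining \<open>n - breaks R w\<close> separators. The case
  distinction is needed because truncated subtraction would otherwise give \<open>1\<close> for too few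
  separators.
\<close>

lemma chain_cuts_eq_binomial:
  assumes "w \<noteq> []"
  shows "chain_cuts R n w =
    (if breaks R w \<le> n then (length w - 1 - breaks R w) choose (n - breaks R w) else 0)"
  using assms
proof (induction w arbitrary: n rule: induct_list012)
  case (2 x)
  show ?case
    by (cases n) auto
next
  case (3 x y w)
  note IH = "3.IH"(2)[OF list.distinct(2)]
  have less: "breaks R (y # w) < length (y # w)"
    by (rule breaks_less_length) simp
  show ?case
  proof (cases n)
    case 0
    then show ?thesis
      using breaks_eq_0_iff[of R "x # y # w"] by auto
  next
    case (Suc k)
    obtain p where p: "length (y # w) = Suc (breaks R (y # w) + p)"
      using less less_iff_Suc_add by blast
    show ?thesis
      unfolding Suc chain_cuts_Cons_Cons IH using p
      by (cases "breaks R (y # w) \<le> k"; cases "breaks R (y # w) = Suc k") (auto simp: Suc_diff_le)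
  qed
qed simp


section \<open>The alternating sum of the numbers of cuts\<close>

text \<open>
  With \<open>x = d + 1\<close> this is the partial fraction expansion of \<open>p! / (x (x + 1) \<dots> (x + p))\<close>, or the
  Beta integral of \<open>t\<^sup>d (1 - t)\<^sup>p\<close>. As a function of \<open>d\<close>, the left-hand side is an iterated
  difference: raising \<open>p\<close> subtracts the value at \<open>d + 1\<close> from the value at \<open>d\<close>, by Pascal's rule.
\<close>

lemma alternating_binomial_reciprocal_sum:
  "(\<Sum>i\<le>p. (-1) ^ i * of_nat (p choose i) / of_nat (Suc (d + i)) :: 'k::field_char_0) =
    fact p * fact d / fact (Suc (d + p))"
proof (induction p arbitrary: d)
  case 0
  show ?case
    by (simp add: divide_simps)
next
  case (Suc p)
  let ?f = "\<lambda>p d. \<Sum>i\<le>p. (-1) ^ i * of_nat (p choose i) / of_nat (Suc (d + i)) :: 'k"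
  have "?f (Suc p) d =
      1 / of_nat (Suc d) + (\<Sum>i\<le>p. (-1) ^ Suc i * of_nat (p choose Suc i) / of_nat (Suc (d + Suc i))) -
      ?f p (Suc d)"
    unfolding sum.atMost_Suc_shift
    by (simp add: sum_subtractf[symmetric] sum.distrib[symmetric] sum_negf[symmetric] algebra_simps add_divide_distrib diff_divide_distrib)
  also have "1 / of_nat (Suc d) + (\<Sum>i\<le>p. (-1) ^ Suc i * of_nat (p choose Suc i) / of_nat (Suc (d + Suc i))) =
      (\<Sum>i\<le>Suc p. (-1) ^ i * of_nat (p choose i) / of_nat (Suc (d + i)) :: 'k)"
    unfolding sum.atMost_Suc_shift by simp
  also have "\<dots> = ?f p d"
    by simp
  also have "?f p d - ?f p (Suc d) = fact (Suc p) * fact d / fact (Suc (d + Suc p))"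
  proof -
    have nz: "(2 + of_nat d + of_nat p :: 'k) \<noteq> 0" "(1 + of_nat d + of_nat p :: 'k) \<noteq> 0"
      using of_nat_neq_0[of "Suc (d + p)", where 'a = 'k] of_nat_neq_0[of "d + p", where 'a = 'k] by (simp_all add: algebra_simps)
    have *: "F * G / E - F * ((1 + of_nat d) * G) / ((2 + of_nat d + of_nat p) * E) =
        ((1 + of_nat p) * F) * G / ((2 + of_nat d + of_nat p) * E)"
      if "E \<noteq> 0" for E F G :: 'k
      using nz that by (simp add: divide_simps) (simp add: algebra_simps)
    have facts: "fact (Suc d) = (1 + of_nat d) * (fact d :: 'k)"
        "fact (Suc p) = (1 + of_nat p) * (fact p :: 'k)"
        "fact (Suc (Suc d + p)) = (2 + of_nat d + of_nat p) * (fact (Suc (d + p)) :: 'k)"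
        "Suc (d + Suc p) = Suc (Suc d + p)"
      by (simp_all add: algebra_simps)
    show ?thesis
      unfolding Suc.IH facts by (rule *[OF fact_nonzero])
  qed
  finally show ?case .
qed

text \<open>
  The coefficient of a word in the logarithm: the \<open>k + 1\<close> factors of a cut come from the power with
  exponent \<open>k + 1\<close>, whose weight in the logarithm is \<open>(-1)\<^sup>k / (k + 1)\<close>.
\<close>

lemma alternating_chain_cuts_sum:
  assumes "w \<noteq> []"
  shows "(\<Sum>k<length w. (-1) ^ k / of_nat (Suc k) * of_nat (chain_cuts R k w)) =
    (-1) ^ breaks R w / (of_nat (length w) * of_nat ((length w - 1) choose breaks R w) :: 'k::field_char_0)"
proof -
  define d where "d = breaks R w"
  obtain p where p: "length w = Suc (d + p)"
    using breaks_less_length[OF assms, of R] less_iff_Suc_add unfolding d_def by blast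
  have "(\<Sum>k<length w. (-1) ^ k / of_nat (Suc k) * of_nat (chain_cuts R k w)) =
      (\<Sum>k\<in>{d..d+p}. (-1) ^ k / of_nat (Suc k) * of_nat (p choose (k - d)) :: 'k)"
    unfolding chain_cuts_eq_binomial[OF assms] d_def[symmetric] p
    by (intro sum.mono_neutral_cong_right) auto
  also have "\<dots> = (-1) ^ d * (\<Sum>i\<le>p. (-1) ^ i * of_nat (p choose i) / of_nat (Suc (d + i)))"
    unfolding sum_distrib_left
    by (rule sum.reindex_bij_witness[of _ "\<lambda>i. d + i" "\<lambda>k. k - d"])
      (auto simp: power_add[symmetric])
  also have "\<dots> = (-1) ^ d / (of_nat (Suc (d + p)) * of_nat ((d + p) choose d))"
    unfolding alternating_binomial_reciprocal_sum
    by (simp add: binomial_fact field_simps)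
  finally show ?thesis
    by (simp add: p d_def)
qed


section \<open>The logarithm as a sum over words\<close>

definition words :: "nat \<Rightarrow> nat \<Rightarrow> nat list set" where
  "words N m = {w. set w \<subseteq> {..<N} \<and> length w = m}"

lemma finite_words [simp]: "finite (words N m)"
  unfolding words_def by (rule finite_lists_length_eq) simp

lemma sum_words_append:
  assumes "i \<le> m"
  shows "(\<Sum>u\<in>words N i. \<Sum>v\<in>words N (m - i). f u v) =
    (\<Sum>w\<in>words N m. f (take i w) (drop i w))"
  unfolding sum.cartesian_product
  by (rule sum.reindex_bij_witness[of _ "\<lambda>w. (take i w, drop i w)" "\<lambda>(u, v). u @ v"])
    (use assms in \<open>auto simp: words_def dest: in_set_takeD in_set_dropD\<close>)

text \<open>
  The product of two sums over \<open>{..<N}\<close> splits by whether the first index is larger than, smaller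
  than or equal to the second; the three parts are the sums of \<open>f \<prec> g\<close>, \<open>f \<succ> g\<close> and \<open>f \<cdot> g\<close>.
\<close>

lemma summation_tri_star:
  "summation (tri_star f g) N = summation f N * summation g N"
  by (induction N) (simp_all add: summation_def tri_star_def tri_prec_def tri_succ_def tri_dot_def
      algebra_simps)

lemma summation_star_power_Suc_Suc:
  "summation (star_power x (Suc (Suc n))) N = summation x N * summation (star_power x (Suc n)) N"
  by (simp add: star_power_def summation_tri_star)

text \<open>
  Both \<open>\<prec>\<close> and \<open>\<preceq>\<close> have the form \<open>(a \<diamond> g)(r) = a(r) S(g)(b(r))\<close>, with \<open>b(r) = r\<close> and
  \<open>b(r) = r + 1\<close>. The iterated right products are nested sums, in which each index is bounded by the
  preceding one; the bound on \<open>b\<close> makes the relation transitive and keeps all indices below \<open>N\<close>.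
\<close>

lemma summation_funpow_eq_sum_chains:
  fixes a :: "nat \<Rightarrow> 'b::{ring,monoid_mult}"
  assumes R: "\<And>r s. R r s \<longleftrightarrow> s < b r" and b: "\<And>r. b r \<le> Suc r"
    and tri: "\<And>g r. tri a g r = a r * summation g (b r)"
  shows "summation ((tri a ^^ k) a) N =
    (\<Sum>w | w \<in> words N (Suc k) \<and> successively R w. prod_list (map a w))"
proof (induction k arbitrary: N)
  case 0
  show ?case
    unfolding summation_def
    by (rule sum.reindex_bij_witness[of _ hd "\<lambda>r. [r]"]) (auto simp: words_def length_Suc_conv)
next
  case (Suc k)
  have "transp R"
    unfolding transp_def R using b by (meson less_Suc_eq_le order_less_le_trans order_le_less_trans)
  have sorted: "successively R w \<longleftrightarrow> sorted_wrt R w" for w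
    by (rule successively_iff_sorted_wrt_strong) (use \<open>transp R\<close> in \<open>auto dest: transpD\<close>)
  \<comment> \<open>In the sorted form of a chain the first letter bounds all others, so the rest of the word is
    a chain over the letters below \<open>b r\<close>, to which the induction hypothesis applies.\<close>
  have "summation ((tri a ^^ Suc k) a) N =
      (\<Sum>r<N. \<Sum>w | w \<in> words (b r) (Suc k) \<and> successively R w. prod_list (map a (r # w)))"
    by (simp add: summation_def[of _ N] tri Suc.IH sum_distrib_left)
  also have "\<dots> = (\<Sum>(r, w)\<in>(SIGMA r:{..<N}. {w. w \<in> words (b r) (Suc k) \<and> successively R w}).
      prod_list (map a (r # w)))"
    by (rule sum.Sigma) auto
  also have "\<dots> = (\<Sum>w | w \<in> words N (Suc (Suc k)) \<and> successively R w. prod_list (map a w))"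
  proof (rule sum.reindex_bij_witness[of _ "\<lambda>w. (hd w, tl w)" "\<lambda>(r, w). r # w"])
    fix p assume "p \<in> (SIGMA r:{..<N}. {w. w \<in> words (b r) (Suc k) \<and> successively R w})"
    then obtain r w where p: "p = (r, w)" "r < N" "set w \<subseteq> {..<b r}" "length w = Suc k"
        "sorted_wrt R w"
      by (auto simp: words_def sorted)
    have "s < N" if "s \<in> set w" for s
      using p(2,3) b[of r] that by fastforce
    then have "r # w \<in> words N (Suc (Suc k)) \<and> successively R (r # w)"
      unfolding sorted using p by (auto simp: words_def R)
    then show "(case p of (r, w) \<Rightarrow> r # w) \<in> {w. w \<in> words N (Suc (Suc k)) \<and> successively R w}"
      using p(1) by simp
  qed (unfold sorted, auto simp: words_def R length_Suc_conv)
  finally show ?case .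
qed

text \<open>
  Multiplication of power series concatenates words, so the coefficients of a word multiply along
  all ways to cut it in two.
\<close>

lemma summation_star_power_nth:
  fixes scale :: "'k::field_char_0 \<Rightarrow> 'b::{ring,monoid_mult} \<Rightarrow> 'b"
  assumes "unital_algebra scale"
    and base: "\<And>m. summation x N $ m =
      (\<Sum>w\<in>words N m. scale (of_nat (chain_cuts R 0 w)) (prod_list (map a w)))"
  shows "summation (star_power x (Suc n)) N $ m =
    (\<Sum>w\<in>words N m. scale (of_nat (chain_cuts R n w)) (prod_list (map a w)))"
proof (induction n arbitrary: m)
  case 0
  show ?case
    by (simp add: base star_power_def del: chain_cuts.simps)
next
  case (Suc n)
  interpret unital_algebra scale by fact
  let ?c = "\<lambda>u v. of_nat (chain_cuts R 0 u) * of_nat (chain_cuts R n v) :: 'k"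
  have "summation (star_power x (Suc (Suc n))) N $ m =
      (\<Sum>i\<le>m. \<Sum>u\<in>words N i. \<Sum>v\<in>words N (m - i). scale (?c u v) (prod_list (map a (u @ v))))"
    unfolding summation_star_power_Suc_Suc fps_mult_nth Suc.IH base sum_product atLeast0AtMost
    by (simp only: scale_mult_left scale_mult_right scale_scale map_append prod_list.append mult.commute[of "of_nat (chain_cuts R n _)" "of_nat _"])
  also have "\<dots> = (\<Sum>i\<le>m. \<Sum>w\<in>words N m. scale (?c (take i w) (drop i w)) (prod_list (map a w)))"
    by (rule sum.cong) (simp_all only: atMost_iff sum_words_append append_take_drop_id)
  also have "\<dots> = (\<Sum>w\<in>words N m. scale (of_nat (chain_cuts R (Suc n) w)) (prod_list (map a w)))"
  proof (subst sum.swap, rule sum.cong[OF refl])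
    fix w assume "w \<in> words N m"
    then show "(\<Sum>i\<le>m. scale (?c (take i w) (drop i w)) (prod_list (map a w))) =
        scale (of_nat (chain_cuts R (Suc n) w)) (prod_list (map a w))"
      by (simp only: words_def mem_Collect_eq chain_cuts.simps of_nat_sum of_nat_mult scale_sum_left)
  qed
  finally show ?case .
qed

lemma summation_star_log_nth:
  fixes scale :: "'k::field_char_0 \<Rightarrow> 'b::{ring,monoid_mult} \<Rightarrow> 'b"
  assumes "unital_algebra scale"
    and R: "\<And>r s. R r s \<longleftrightarrow> s < b r" and b: "\<And>r. b r \<le> Suc r"
    and tri: "\<And>g r. tri a g r = a r * summation g (b r)"
    and X: "snd X = (\<lambda>N. Abs_fps (\<lambda>m. case m of 0 \<Rightarrow> 0 | Suc k \<Rightarrow> (tri a ^^ k) a N))"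
  shows "summation (star_log scale X) N $ m = (if m > 0 then
    (\<Sum>w\<in>words N m. scale
      ((-1) ^ breaks R w / (of_nat m * of_nat ((m - 1) choose breaks R w))) (prod_list (map a w))) else 0)"
proof -
  interpret unital_algebra scale by fact
  have base: "summation (snd X) N $ m =
      (\<Sum>w\<in>words N m. scale (of_nat (chain_cuts R 0 w)) (prod_list (map a w)))" for m
  proof (cases m)
    case 0
    then show ?thesis
      by (auto simp: words_def summation_nth X summation_def[of "\<lambda>_. 0"])
  next
    case (Suc k)
    have "summation (snd X) N $ m = summation ((tri a ^^ k) a) N"
      by (simp add: summation_nth X Suc)
    also have "\<dots> = (\<Sum>w | w \<in> words N m \<and> successively R w. prod_list (map a w))"
      unfolding Suc by (rule summation_funpow_eq_sum_chains[where tri = tri and b = b and R = R, OF R b tri])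
    also have "\<dots> = (\<Sum>w\<in>words N m. scale (of_nat (chain_cuts R 0 w)) (prod_list (map a w)))"
      by (rule sum.mono_neutral_cong_left[OF finite_words]) (auto simp: words_def Suc)
    finally show ?thesis .
  qed
  have "summation (star_log scale X) N $ m =
      - (\<Sum>n=1..m. scale ((-1) ^ n / of_nat n) (summation (star_power (snd X) n) N $ m))"
    unfolding summation_nth
    by (simp add: star_log_def summation_def sum_negf scale_sum_right sum.swap[of _ "{..<N}"])
  also have "\<dots> =
      (\<Sum>k<m. scale ((-1) ^ k / of_nat (Suc k)) (summation (star_power (snd X) (Suc k)) N $ m))"
    by (simp add: sum.atLeast1_atMost_eq sum_negf)
  also have "\<dots> = (\<Sum>w\<in>words N m. scale
      (\<Sum>k<m. (-1) ^ k / of_nat (Suc k) * of_nat (chain_cuts R k w)) (prod_list (map a w)))"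
    unfolding summation_star_power_nth[OF \<open>unital_algebra scale\<close> base]
    by (simp only: scale_sum_right scale_sum_left scale_scale sum.swap[of _ "{..<m}"])
  also have "\<dots> = (if m > 0 then
    (\<Sum>w\<in>words N m. scale
      ((-1) ^ breaks R w / (of_nat m * of_nat ((m - 1) choose breaks R w))) (prod_list (map a w))) else 0)"
  proof (cases "m > 0")
    case True
    have "(\<Sum>k<m. (-1) ^ k / of_nat (Suc k) * of_nat (chain_cuts R k w)) =
        ((-1) ^ breaks R w / (of_nat m * of_nat ((m - 1) choose breaks R w)) :: 'k)"
      if "w \<in> words N m" for w
    proof -
      have "w \<noteq> []" "length w = m"
        using that True by (auto simp: words_def)
      from alternating_chain_cuts_sum[OF this(1), of R, where 'k = 'k] show ?thesis
        unfolding \<open>length w = m\<close> .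
    qed
    with True show ?thesis
      by (simp only: if_True cong: sum.cong)
  qed simp
  finally show ?thesis .
qed


section \<open>Grouping words by their relative order\<close>

text \<open>
  The candidate for the surjection \<open>\<sigma>\<close> with \<open>s \<in> T\<^sub>\<sigma>(N)\<close>: the values of \<open>s\<close> are numbered from the
  largest downwards, since larger values of \<open>s\<close> correspond to smaller values of \<open>\<sigma>\<close>.
\<close>

definition descending_rank :: "nat \<Rightarrow> (nat \<Rightarrow> nat) \<Rightarrow> nat \<Rightarrow> nat" where
  "descending_rank n s = (\<lambda>i\<in>{1..n}. card {v \<in> s ` {1..n}. s i \<le> v})"

lemma finite_ST: "finite (ST n)"
proof (rule finite_subset)
  show "ST n \<subseteq> {1..n} \<rightarrow>\<^sub>E {1..n}"
    unfolding ST_def PiE_def Pi_def by fastforce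
qed (simp add: finite_PiE)

text \<open>
  Distinct values have distinct ranks between \<open>1\<close> and the number \<open>r\<close> of values, so all of
  \<open>{1..r}\<close> is attained.
\<close>

lemma descending_rank_in_ST:
  assumes "n > 0"
  shows "descending_rank n s \<in> ST n"
proof -
  let ?V = "s ` {1..n}"
  let ?g = "\<lambda>u. card {v \<in> ?V. u \<le> v}"
  have fin: "finite ?V" by simp
  have card_V: "card ?V \<in> {1..n}"
    using assms card_image_le[of "{1..n}" s] card_gt_0_iff[of ?V] by fastforce
  have inj: "inj_on ?g ?V"
  proof (rule linorder_inj_onI)
    fix u v assume "u < v" "u \<in> ?V" "v \<in> ?V"
    then have "u \<in> {w \<in> ?V. u \<le> w} - {w \<in> ?V. v \<le> w}"
      by simp
    with \<open>u < v\<close> have "?g v < ?g u"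
      by (intro psubset_card_mono) (simp, fastforce)
    then show "?g u \<noteq> ?g v" by simp
  qed auto
  have "?g ` ?V \<subseteq> {1..card ?V}"
  proof safe
    fix i assume "i \<in> {1..n}"
    then have "{v \<in> ?V. s i \<le> v} \<noteq> {}" by auto
    then have "?g (s i) > 0" by (simp add: card_gt_0_iff)
    moreover have "?g (s i) \<le> card ?V" by (intro card_mono) auto
    ultimately show "?g (s i) \<in> {1..card ?V}" by simp
  qed
  then have "?g ` ?V = {1..card ?V}"
    by (intro card_subset_eq) (use card_image[OF inj] in simp_all)
  then have "descending_rank n s ` {1..n} = {1..card ?V}"
    by (simp add: descending_rank_def image_image)
  then show ?thesis
    unfolding ST_def using card_V by (auto simp: descending_rank_def)
qed

lemma descending_rank_less_iff:
  assumes "i \<in> {1..n}" "j \<in> {1..n}"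
  shows "descending_rank n s i < descending_rank n s j \<longleftrightarrow> s j < s i"
proof -
  have *: "descending_rank n s i < descending_rank n s j"
    if "s j < s i" "i \<in> {1..n}" "j \<in> {1..n}" for i j
  proof -
    have "s j \<in> {v \<in> s ` {1..n}. s j \<le> v} - {v \<in> s ` {1..n}. s i \<le> v}"
      using that by simp
    with \<open>s j < s i\<close> have
      "card {v \<in> s ` {1..n}. s i \<le> v} < card {v \<in> s ` {1..n}. s j \<le> v}"
      by (intro psubset_card_mono) (simp, fastforce)
    then show ?thesis
      using that unfolding descending_rank_def by simp
  qed
  have "descending_rank n s i = descending_rank n s j" if "s i = s j"
    using that assms by (simp add: descending_rank_def)
  with *[of i j] *[of j i] assms show ?thesis
    by (metis less_asym' linorder_neqE_nat less_irrefl)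
qed

lemma card_image_eq_if_same_kernel:
  assumes "\<And>u v. u \<in> A \<Longrightarrow> v \<in> A \<Longrightarrow> f u = f v \<longleftrightarrow> g u = g v"
  shows "card (f ` A) = card (g ` A)"
proof (rule bij_betw_same_card)
  have *: "g (inv_into A f (f u)) = g u" if "u \<in> A" for u
    using assms that by (meson f_inv_into_f image_eqI inv_into_into)
  have "inj_on (\<lambda>y. g (inv_into A f y)) (f ` A)"
    by (auto intro!: inj_onI simp: * assms)
  moreover have "(\<lambda>y. g (inv_into A f y)) ` f ` A = g ` A"
    unfolding image_image using * by (rule image_cong[OF refl])
  ultimately show "bij_betw (\<lambda>y. g (inv_into A f y)) (f ` A) (g ` A)"
    by (simp add: bij_betw_def)
qed

text \<open>
  The order type determines \<open>\<sigma>\<close> because its image is an initial segment \<open>{1..r}\<close>: the value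
  \<open>\<sigma> i\<close> is the number of values of \<open>\<sigma>\<close> up to \<open>\<sigma> i\<close>, and these correspond one to one to the values
  of \<open>s\<close> from \<open>s i\<close> upwards.
\<close>

lemma ST_eq_descending_rank:
  assumes "\<sigma> \<in> ST n" "s \<in> T n \<sigma> N"
  shows "descending_rank n s = \<sigma>"
proof
  fix i
  obtain r where r: "\<sigma> ` {1..n} = {1..r}" and ext: "\<sigma> \<in> extensional {1..n}"
    using assms(1) by (auto simp: ST_def)
  have less: "s v < s u \<longleftrightarrow> \<sigma> u < \<sigma> v" and eq: "s u = s v \<longleftrightarrow> \<sigma> u = \<sigma> v"
    if "u \<in> {1..n}" "v \<in> {1..n}" for u v
    using assms(2) that by (auto simp: T_def)
  show "descending_rank n s i = \<sigma> i"
  proof (cases "i \<in> {1..n}")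
    case True
    define J where "J = {j \<in> {1..n}. s i \<le> s j}"
    have J: "J = {j \<in> {1..n}. \<sigma> j \<le> \<sigma> i}"
      unfolding J_def using less[OF True] less[OF _ True] by (meson linorder_not_le)
    have "card (s ` J) = card (\<sigma> ` J)"
      by (rule card_image_eq_if_same_kernel) (auto simp: J_def eq)
    moreover have "{v \<in> s ` {1..n}. s i \<le> v} = s ` J"
      by (auto simp: J_def)
    moreover have "\<sigma> ` J = {1..\<sigma> i}"
    proof -
      have "\<sigma> ` J = {k \<in> \<sigma> ` {1..n}. k \<le> \<sigma> i}"
        unfolding J by auto
      also have "\<dots> = {1..\<sigma> i}"
      proof -
        have "\<sigma> i \<in> {1..r}"
          using True unfolding r[symmetric] by (rule imageI)
        then show ?thesis
          unfolding r by auto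
      qed
      finally show ?thesis .
    qed
    ultimately show ?thesis
      using True by (simp add: descending_rank_def)
  next
    case False
    then show ?thesis
      by (simp only: descending_rank_def restrict_def if_False extensional_arb[OF ext False])
  qed
qed

lemma T_eq_descending_rank_fiber:
  assumes "n > 0" "\<sigma> \<in> ST n"
  shows "T n \<sigma> N = {s \<in> {1..n} \<rightarrow>\<^sub>E {0..<N}. descending_rank n s = \<sigma>}"
proof (intro equalityI subsetI)
  fix s assume "s \<in> T n \<sigma> N"
  with ST_eq_descending_rank[OF assms(2) this]
  show "s \<in> {s \<in> {1..n} \<rightarrow>\<^sub>E {0..<N}. descending_rank n s = \<sigma>}"
    by (simp add: T_def)
next
  fix s assume s: "s \<in> {s \<in> {1..n} \<rightarrow>\<^sub>E {0..<N}. descending_rank n s = \<sigma>}"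
  then have less: "s j < s i \<longleftrightarrow> \<sigma> i < \<sigma> j" if "i \<in> {1..n}" "j \<in> {1..n}" for i j
    using descending_rank_less_iff[OF that, of s] by simp
  then have "s i = s j \<longleftrightarrow> \<sigma> i = \<sigma> j" if "i \<in> {1..n}" "j \<in> {1..n}" for i j
    using that by (metis linorder_neq_iff)
  with s less show "s \<in> T n \<sigma> N"
    by (simp add: T_def)
qed

text \<open>
  If on each \<open>T\<^sub>\<sigma>(N)\<close> the statistic \<open>d\<close> is the number of unrelated adjacent letters, the double
  sum over \<open>\<sigma>\<close> and \<open>T\<^sub>\<sigma>(N)\<close> collapses to one sum over all words.
\<close>

lemma magnus_series_nth:
  fixes scale :: "'k::field_char_0 \<Rightarrow> 'b::{ring,monoid_mult} \<Rightarrow> 'b"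
  assumes "unital_algebra scale" "m > 0"
    and d: "\<And>\<sigma> s. s \<in> T m \<sigma> N \<Longrightarrow> d m \<sigma> = breaks R (map s [1..<m + 1])"
  shows "magnus_series scale d a N $ m =
    (\<Sum>w\<in>words N m. scale
      ((-1) ^ breaks R w / (of_nat m * of_nat ((m - 1) choose breaks R w))) (prod_list (map a w)))"
proof -
  interpret unital_algebra scale by fact
  let ?S = "{1..m} \<rightarrow>\<^sub>E {0..<N}"
  let ?f = "\<lambda>w. scale
      ((-1) ^ breaks R w / (of_nat m * of_nat ((m - 1) choose breaks R w))) (prod_list (map a w))"
  let ?w = "\<lambda>s. map s [1..<m + 1]"
  have "magnus_series scale d a N $ m = (\<Sum>\<sigma>\<in>ST m. \<Sum>s\<in>T m \<sigma> N. ?f (?w s))"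
  proof -
    have "scale ((-1) ^ d m \<sigma> / (of_nat m * of_nat ((m - 1) choose d m \<sigma>)))
        (\<Sum>s\<in>T m \<sigma> N. ordered_product a m s) = (\<Sum>s\<in>T m \<sigma> N. ?f (?w s))" for \<sigma>
      unfolding scale_sum_right ordered_product_def map_map o_def
    proof (rule sum.cong[OF refl])
      fix s assume "s \<in> T m \<sigma> N"
      from d[OF this] show "scale ((-1) ^ d m \<sigma> / (of_nat m * of_nat ((m - 1) choose d m \<sigma>)))
          (prod_list (map (\<lambda>i. a (s i)) [1..<m + 1])) =
        scale ((-1) ^ breaks R (?w s) / (of_nat m * of_nat ((m - 1) choose breaks R (?w s))))
          (prod_list (map (\<lambda>i. a (s i)) [1..<m + 1]))"
        by (simp only:)
    qed
    then show ?thesis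
      using \<open>m > 0\<close> by (simp add: magnus_series_def)
  qed
  also have "\<dots> = (\<Sum>\<sigma>\<in>ST m. \<Sum>s | s \<in> ?S \<and> descending_rank m s = \<sigma>. ?f (?w s))"
    using T_eq_descending_rank_fiber[OF \<open>m > 0\<close>] by (intro sum.cong) auto
  also have "\<dots> = (\<Sum>s\<in>?S. ?f (?w s))"
    using descending_rank_in_ST[OF \<open>m > 0\<close>]
    by (intro sum.group) (auto simp: finite_ST finite_PiE)
  also have "\<dots> = (\<Sum>w\<in>words N m. ?f w)"
  proof (rule sum.reindex_bij_witness[of _ "\<lambda>w. \<lambda>i\<in>{1..m}. w ! (i - 1)" ?w])
    fix s assume s: "s \<in> ?S"
    then show "?w s \<in> words N m"
      by (auto simp: words_def)
    show "(\<lambda>i\<in>{1..m}. ?w s ! (i - 1)) = s"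
      using s by (auto simp: fun_eq_iff PiE_def extensional_def simp del: upt_Suc)
  next
    fix w assume w: "w \<in> words N m"
    have "w ! (i - 1) \<in> {0..<N}" if "i \<in> {1..m}" for i
    proof -
      have "w ! (i - 1) \<in> set w"
        using w that by (intro nth_mem) (auto simp: words_def)
      then show ?thesis
        using w by (auto simp: words_def)
    qed
    then show "(\<lambda>i\<in>{1..m}. w ! (i - 1)) \<in> ?S"
      by (simp only: restrict_PiE_iff ball_simps) blast
    show "?w (\<lambda>i\<in>{1..m}. w ! (i - 1)) = w"
      using w by (auto simp: words_def intro!: nth_equalityI simp del: upt_Suc)
  qed simp
  finally show ?thesis .
qed

lemma descents_eq_breaks:
  assumes "s \<in> T m \<sigma> N"
  shows "descents m \<sigma> = breaks (\<lambda>r s. s < r) (map s [1..<m + 1])"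
proof -
  have "s j \<le> s (j + 1) \<longleftrightarrow> \<sigma> (j + 1) \<le> \<sigma> j" if "j \<in> {1..<m}" for j
    using assms that unfolding T_def by (simp add: linorder_not_less[symmetric])
  then show ?thesis
    unfolding descents_def breaks_map_upt not_less
    by (intro arg_cong[where f = card]) blast
qed

lemma strict_descents_eq_breaks:
  assumes "s \<in> T m \<sigma> N"
  shows "strict_descents m \<sigma> = breaks (\<lambda>r s. s \<le> r) (map s [1..<m + 1])"
proof -
  have "s j < s (j + 1) \<longleftrightarrow> \<sigma> (j + 1) < \<sigma> j" if "j \<in> {1..<m}" for j
    using assms that unfolding T_def by simp
  then show ?thesis
    unfolding strict_descents_def breaks_map_upt not_le
    by (intro arg_cong[where f = card]) blast
qed

lemma magnus_series_nth_0: "magnus_series scale d a N $ 0 = 0"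
  by (simp add: magnus_series_def)

theorem corollary11:
  fixes scale :: "'k::field_char_0 \<Rightarrow> 'b::{ring,monoid_mult} \<Rightarrow> 'b"
    and a :: "nat \<Rightarrow> 'b"
    and X Xbar :: "'k \<times> (nat \<Rightarrow> 'b fps)"
  assumes "unital_algebra scale"
    and "X = one_plus (aug_prec scale (formal_seq a) X)"
    and "Xbar = one_plus (aug_preceq scale (formal_seq a) Xbar)"
  shows "summation (star_log scale X) N = magnus_series scale descents a N \<and>
    summation (star_log scale Xbar) N = magnus_series scale strict_descents a N"
proof
  note alg = assms(1)
  have X: "snd X = (\<lambda>N. Abs_fps (\<lambda>m. case m of 0 \<Rightarrow> 0 | Suc k \<Rightarrow> (tri_prec a ^^ k) a N))"
    using assms(2) unfolding aug_prec_fixed_point_iff[OF alg] by (simp add: one_plus_def)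
  have "summation (star_log scale X) N $ m = magnus_series scale descents a N $ m" for m
    by (simp add: summation_star_log_nth[where R = "\<lambda>r s. s < r" and b = "\<lambda>r. r" and tri = tri_prec and a = a, OF alg _ _ _ X] tri_prec_def magnus_series_nth[OF alg _ descents_eq_breaks] magnus_series_nth_0)
  then show "summation (star_log scale X) N = magnus_series scale descents a N"
    by (simp add: fps_eq_iff)
  have Xbar: "snd Xbar = (\<lambda>N. Abs_fps (\<lambda>m. case m of 0 \<Rightarrow> 0 | Suc k \<Rightarrow> (tri_preceq a ^^ k) a N))"
    using assms(3) unfolding aug_preceq_fixed_point_iff[OF alg] by (simp add: one_plus_def)
  have preceq: "tri_preceq a g r = a r * summation g (Suc r)" for g r
    by (simp add: tri_preceq_def tri_prec_def tri_dot_def summation_def distrib_left)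
  have "summation (star_log scale Xbar) N $ m = magnus_series scale strict_descents a N $ m" for m
    by (simp add: summation_star_log_nth[where R = "\<lambda>r s. s \<le> r" and b = Suc and tri = tri_preceq and a = a, OF alg _ _ preceq Xbar]
         less_Suc_eq_le magnus_series_nth[OF alg _ strict_descents_eq_breaks]
        magnus_series_nth_0)
  then show "summation (star_log scale Xbar) N = magnus_series scale strict_descents a N"
    by (simp add: fps_eq_iff)
qed

end
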